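(* Let $m\ge 1$ be an integer. For every matrix $A=\begin{bmatrix}A_{11}&A_{12}\\ A_{21}&A_{22}\end{bmatrix}\in\mathbb{R}^{2m\times 2m}$, partitioned into $m\times m$ blocks, the nearest symmetric skew-Hamiltonian matrix to $A$ in Frobenius norm exists, is unique, and is given by $$\operatorname*{argmin}_{M\in\mathrm{SSkH}(2m)}\|A-M\|_{\mathrm F}=\mathrm{sskh}(A):=\frac12\begin{bmatrix}\mathrm{sym}(A_{11}+A_{22})&-\mathrm{skew}(A_{21}-A_{12})\\ \mathrm{skew}(A_{21}-A_{12})&\mathrm{sym}(A_{11}+A_{22})\end{bmatrix}.$$
   Context: For a square real matrix $B$, $\mathrm{sym}(B)=\frac12(B+B^\top)$ and $\mathrm{skew}(B)=\frac12(B-B^\top)$. $\mathrm{Sym}(m)$ and $\mathrm{Skew}(m)$ denote the sets of real symmetric and real skew-symmetric $m\times m$ matrices. The set of $2m\times 2m$ symmetric skew-Hamiltonian matrices is $$\mathrm{SSkH}(2m)=\left\{\begin{bmatrix}\widetilde H&-\widetilde\Omega\\ \widetilde\Omega&\widetilde H\end{bmatrix}\ :\ \widetilde H\in\mathrm{Sym}(m),\ \widetilde\Omega\in\mathrm{Skew}(m)\right\}.$$ $\|\cdot\|_{\mathrm F}$ is the Frobenius norm. *)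

theory Defs
  imports Complex_Main "Jordan_Normal_Form.Matrix"
begin

(* The matrix operations of Jordan_Normal_Form.Matrix take their dimensions from one of the
   arguments; the definitions below are only meaningful for arguments of the right dimensions. *)

definition mat_sym :: "real mat \<Rightarrow> real mat" where
  "mat_sym B = (1/2) \<cdot>\<^sub>m (B + transpose_mat B)"

definition mat_skew :: "real mat \<Rightarrow> real mat" where
  "mat_skew B = (1/2) \<cdot>\<^sub>m (B - transpose_mat B)"

definition Sym :: "nat \<Rightarrow> real mat set" where
  "Sym m = {H \<in> carrier_mat m m. transpose_mat H = H}"

definition Skew :: "nat \<Rightarrow> real mat set" where
  "Skew m = {W \<in> carrier_mat m m. transpose_mat W = - W}"

(* The argument is the block size m; the matrices themselves are 2m x 2m. *)
definition SSkH :: "nat \<Rightarrow> real mat set" where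
  "SSkH m = {four_block_mat H (- W) W H | H W. H \<in> Sym m \<and> W \<in> Skew m}"

definition frobenius_norm :: "real mat \<Rightarrow> real" where
  "frobenius_norm A = sqrt (\<Sum>i<dim_row A. \<Sum>j<dim_col A. (A $$ (i, j))\<^sup>2)"

definition sskh :: "nat \<Rightarrow> real mat \<Rightarrow> real mat" where
  "sskh m A = (case split_block A m m of (A11, A12, A21, A22) \<Rightarrow>
     (1/2) \<cdot>\<^sub>m four_block_mat
        (mat_sym (A11 + A22))     (- mat_skew (A21 - A12))
        (mat_skew (A21 - A12))    (mat_sym (A11 + A22)))"

lemma sskh_four_block_mat:
  assumes "A11 \<in> carrier_mat m m" "A12 \<in> carrier_mat m m"
    and "A21 \<in> carrier_mat m m" "A22 \<in> carrier_mat m m"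
  shows "sskh m (four_block_mat A11 A12 A21 A22) =
    (1/2) \<cdot>\<^sub>m four_block_mat
        (mat_sym (A11 + A22))     (- mat_skew (A21 - A12))
        (mat_skew (A21 - A12))    (mat_sym (A11 + A22))"
proof -
  have "split_block (four_block_mat A11 A12 A21 A22) m m = (A11, A12, A21, A22)"
    using assms unfolding split_block_def Let_def by (auto intro!: eq_matI)
  then show ?thesis by (simp add: sskh_def)
qed

end

theory Submission
  imports Defs
begin

text \<open>
  The symmetric skew-Hamiltonian matrices form a linear subspace of the real matrices, and the
  Frobenius norm is Euclidean, so the nearest point exists, is unique, and is the orthogonal
  projection of \<open>A\<close>: the element \<open>P\<close> of the subspace with \<open>A - P\<close> orthogonal to the subspace.
  By Pythagoras, \<open>\<parallel>A - M\<parallel>\<^sup>2 = \<parallel>A - P\<parallel>\<^sup>2 + \<parallel>P - M\<parallel>\<^sup>2\<close> for every \<open>M\<close> in it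
  (lemma \<open>arg_min_frobenius_eqI\<close>).

  That \<open>sskh m A\<close> is this projection comes from pairing with an element of the subspace that has
  diagonal blocks \<open>H\<close> and off-diagonal blocks \<open>- W\<close> and \<open>W\<close>. The pairing sees \<open>A\<close> only through
  \<open>\<langle>A11 + A22, H\<rangle> + \<langle>A21 - A12, W\<rangle>\<close> (lemma \<open>frob_inner_SSkH_pattern\<close>). As symmetric and
  skew-symmetric matrices are orthogonal, it depends only on the symmetric part of \<open>A11 + A22\<close>
  and the skew part of \<open>A21 - A12\<close>, which are the data from which \<open>sskh m A\<close> is built. The
  factor 1/2 compensates for each of the two occurring in two blocks.
\<close>

section \<open>The Frobenius inner product and orthogonal projection\<close>

definition frob_inner :: "real mat \<Rightarrow> real mat \<Rightarrow> real" where
  "frob_inner A B = (\<Sum>i<dim_row A. \<Sum>j<dim_col A. A $$ (i, j) * B $$ (i, j))"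

lemma frobenius_norm_eq_sqrt_frob_inner: "frobenius_norm A = sqrt (frob_inner A A)"
  by (simp add: frobenius_norm_def frob_inner_def power2_eq_square)

lemma frob_inner_self_nonneg: "frob_inner A A \<ge> 0"
  by (auto simp: frob_inner_def intro!: sum_nonneg)

lemma frob_inner_self_eq_0D:
  assumes "A \<in> carrier_mat n k" and "frob_inner A A = 0"
  shows "A = 0\<^sub>m n k"
proof (rule eq_matI)
  fix i j assume ij: "i < dim_row (0\<^sub>m n k)" "j < dim_col (0\<^sub>m n k)"
  have "\<forall>i\<in>{..<n}. (\<Sum>j<k. A $$ (i, j) * A $$ (i, j)) = 0"
    using assms by (subst sum_nonneg_eq_0_iff [symmetric]) (auto simp: frob_inner_def intro: sum_nonneg)
  then have "\<forall>j\<in>{..<k}. A $$ (i, j) * A $$ (i, j) = 0"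
    using ij by (subst sum_nonneg_eq_0_iff [symmetric]) auto
  then show "A $$ (i, j) = 0\<^sub>m n k $$ (i, j)"
    using ij by auto
qed (use assms in auto)

lemma frob_inner_add_left:
  assumes "A \<in> carrier_mat n k" "B \<in> carrier_mat n k"
  shows "frob_inner (A + B) C = frob_inner A C + frob_inner B C"
  using assms by (simp add: frob_inner_def sum.distrib distrib_right)

lemma frob_inner_minus_left:
  assumes "A \<in> carrier_mat n k" "B \<in> carrier_mat n k"
  shows "frob_inner (A - B) C = frob_inner A C - frob_inner B C"
  using assms by (simp add: frob_inner_def sum_subtractf left_diff_distrib)

lemma frob_inner_uminus_left: "frob_inner (- A) C = - frob_inner A C"
  by (simp add: frob_inner_def sum_negf)

lemma frob_inner_smult_left: "frob_inner (c \<cdot>\<^sub>m A) C = c * frob_inner A C"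
  by (simp add: frob_inner_def sum_distrib_left mult.assoc)

lemma frob_inner_commute:
  assumes "A \<in> carrier_mat n k" "B \<in> carrier_mat n k"
  shows "frob_inner A B = frob_inner B A"
  using assms by (simp add: frob_inner_def mult.commute)

lemma frob_inner_uminus_right:
  assumes "A \<in> carrier_mat n k" "B \<in> carrier_mat n k"
  shows "frob_inner A (- B) = - frob_inner A B"
  using assms by (simp add: frob_inner_def sum_negf)

lemma frob_inner_transpose:
  assumes "A \<in> carrier_mat n k" "B \<in> carrier_mat n k"
  shows "frob_inner (transpose_mat A) (transpose_mat B) = frob_inner A B"
proof -
  have "frob_inner (transpose_mat A) (transpose_mat B)
      = (\<Sum>j<k. \<Sum>i<n. A $$ (i, j) * B $$ (i, j))"
    using assms by (auto simp: frob_inner_def intro!: sum.cong)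
  also have "\<dots> = frob_inner A B"
    using assms by (subst sum.swap) (auto simp: frob_inner_def)
  finally show ?thesis .
qed

lemma frob_inner_pythagoras:
  assumes "A \<in> carrier_mat n k" "P \<in> carrier_mat n k" "M \<in> carrier_mat n k"
    and orth: "frob_inner (A - P) (P - M) = 0"
  shows "frob_inner (A - M) (A - M) = frob_inner (A - P) (A - P) + frob_inner (P - M) (P - M)"
proof -
  have X: "A - P \<in> carrier_mat n k" and Y: "P - M \<in> carrier_mat n k"
    using assms by auto
  have "A - M = (A - P) + (P - M)"
    using assms by (intro eq_matI) auto
  moreover have "frob_inner ((A - P) + (P - M)) ((A - P) + (P - M))
      = frob_inner (A - P) (A - P) + 2 * frob_inner (A - P) (P - M) + frob_inner (P - M) (P - M)"
    using X Y frob_inner_commute[of "A - P" n k "(A - P) + (P - M)"]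
      frob_inner_commute[of "P - M" n k "(A - P) + (P - M)"] frob_inner_commute[OF Y X]
    by (simp add: frob_inner_add_left[OF X Y])
  ultimately show ?thesis
    using orth by simp
qed

text \<open>
  By Pythagoras, moving from \<open>P\<close> to another point of \<open>S\<close> increases the squared distance to \<open>A\<close> by
  a quantity that is positive unless the points coincide. Stating orthogonality for the
  differences \<open>P - M\<close> covers affine subspaces too.
\<close>

lemma arg_min_frobenius_eqI:
  assumes A: "A \<in> carrier_mat n k" and S: "S \<subseteq> carrier_mat n k" and P: "P \<in> S"
    and orth: "\<And>M. M \<in> S \<Longrightarrow> frob_inner (A - P) (P - M) = 0"
  shows "{M. is_arg_min (\<lambda>M. frobenius_norm (A - M)) (\<lambda>M. M \<in> S) M} = {P}"
proof -
  have pyth: "frob_inner (A - M) (A - M)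
      = frob_inner (A - P) (A - P) + frob_inner (P - M) (P - M)" if "M \<in> S" for M
    using A S P that by (intro frob_inner_pythagoras orth) auto
  have le: "frobenius_norm (A - P) \<le> frobenius_norm (A - M)" if "M \<in> S" for M
    using pyth[OF that] frob_inner_self_nonneg[of "P - M"]
    by (simp add: frobenius_norm_eq_sqrt_frob_inner)
  have eq: "M = P" if M: "M \<in> S" and "frobenius_norm (A - M) \<le> frobenius_norm (A - P)" for M
  proof -
    have PM: "P \<in> carrier_mat n k" "M \<in> carrier_mat n k"
      using P M S by auto
    have "frob_inner (P - M) (P - M) = 0"
      using that pyth[OF M] frob_inner_self_nonneg[of "P - M"]
      by (simp add: frobenius_norm_eq_sqrt_frob_inner)
    then have "P - M = 0\<^sub>m n k"
      using PM by (intro frob_inner_self_eq_0D) auto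
    then have "P $$ (i, j) - M $$ (i, j) = 0" if "i < n" "j < k" for i j
      using PM that by (metis carrier_matD index_minus_mat(1) index_zero_mat(1))
    then show ?thesis
      using PM by (intro eq_matI) auto
  qed
  show ?thesis
    using P le eq by (auto simp: is_arg_min_def not_less)
qed

section \<open>Symmetric and skew-symmetric parts\<close>

lemma mat_sym_in_Sym: "B \<in> carrier_mat m m \<Longrightarrow> mat_sym B \<in> Sym m"
  by (auto simp: Sym_def mat_sym_def intro!: eq_matI)

lemma mat_skew_in_Skew: "B \<in> carrier_mat m m \<Longrightarrow> mat_skew B \<in> Skew m"
  by (auto simp: Skew_def mat_skew_def field_simps intro!: eq_matI)

text \<open>
  Since transposition is an isometry, \<open>\<langle>B, H\<rangle> = \<langle>B\<^sup>T, H\<rangle>\<close> for symmetric \<open>H\<close>, so \<open>B\<close> may be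
  replaced by the average of \<open>B\<close> and its transpose. For skew-symmetric \<open>W\<close> it is
  \<open>\<langle>B, W\<rangle> = - \<langle>B\<^sup>T, W\<rangle>\<close>, and half the difference takes the place of the average.
\<close>

lemma frob_inner_mat_sym:
  assumes B: "B \<in> carrier_mat m m" and H: "H \<in> Sym m"
  shows "frob_inner (mat_sym B) H = frob_inner B H"
proof -
  have "frob_inner (transpose_mat B) H = frob_inner B H"
    using frob_inner_transpose[of B m m H] B H by (simp add: Sym_def)
  then show ?thesis
    using B by (simp add: mat_sym_def frob_inner_smult_left frob_inner_add_left[of B m m])
qed

lemma frob_inner_mat_skew:
  assumes B: "B \<in> carrier_mat m m" and W: "W \<in> Skew m"
  shows "frob_inner (mat_skew B) W = frob_inner B W"
proof -
  have "frob_inner (transpose_mat B) W = - frob_inner B W"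
    using frob_inner_transpose[of B m m W] frob_inner_uminus_right[of "transpose_mat B" m m W] B W
    by (simp add: Skew_def)
  then show ?thesis
    using B by (simp add: mat_skew_def frob_inner_smult_left frob_inner_minus_left[of B m m])
qed

section \<open>Pairing with symmetric skew-Hamiltonian matrices\<close>

lemma sum_lessThan_add:
  fixes f :: "nat \<Rightarrow> 'a :: comm_monoid_add"
  shows "(\<Sum>i<m + n. f i) = (\<Sum>i<m. f i) + (\<Sum>i<n. f (m + i))"
  by (induction n) (simp_all add: add.assoc)

lemma frob_inner_four_block_mat:
  assumes "A11 \<in> carrier_mat n k" "A12 \<in> carrier_mat n l"
    and "A21 \<in> carrier_mat p k" "A22 \<in> carrier_mat p l"
    and "B11 \<in> carrier_mat n k" "B12 \<in> carrier_mat n l"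
    and "B21 \<in> carrier_mat p k" "B22 \<in> carrier_mat p l"
  shows "frob_inner (four_block_mat A11 A12 A21 A22) (four_block_mat B11 B12 B21 B22)
    = frob_inner A11 B11 + frob_inner A12 B12 + frob_inner A21 B21 + frob_inner A22 B22"
  using assms by (simp add: frob_inner_def sum_lessThan_add sum.distrib)

lemma frob_inner_SSkH_pattern:
  assumes "A11 \<in> carrier_mat m m" "A12 \<in> carrier_mat m m"
    and "A21 \<in> carrier_mat m m" "A22 \<in> carrier_mat m m"
    and "H \<in> carrier_mat m m" "W \<in> carrier_mat m m"
  shows "frob_inner (four_block_mat A11 A12 A21 A22) (four_block_mat H (- W) W H)
    = frob_inner (A11 + A22) H + frob_inner (A21 - A12) W"
  using assms
  by (simp add: frob_inner_four_block_mat[of _ m m _ m _ m] frob_inner_uminus_right[of _ m m]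
      frob_inner_add_left[of _ m m] frob_inner_minus_left[of _ m m])

lemma SSkH_carrier: "M \<in> SSkH m \<Longrightarrow> M \<in> carrier_mat (2 * m) (2 * m)"
  by (auto simp: SSkH_def Sym_def Skew_def)

lemma transpose_smult_mat: "transpose_mat (c \<cdot>\<^sub>m B) = c \<cdot>\<^sub>m transpose_mat B"
  by (rule eq_matI) auto

lemma Sym_minus: "H \<in> Sym m \<Longrightarrow> H' \<in> Sym m \<Longrightarrow> H - H' \<in> Sym m"
  by (auto simp: Sym_def transpose_minus)

lemma Skew_minus: "W \<in> Skew m \<Longrightarrow> W' \<in> Skew m \<Longrightarrow> W - W' \<in> Skew m"
  by (auto simp: Skew_def transpose_minus intro!: eq_matI)

lemma SSkH_minus:
  assumes "M \<in> SSkH m" "N \<in> SSkH m"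
  shows "M - N \<in> SSkH m"
proof -
  obtain H W where M: "M = four_block_mat H (- W) W H" and HW: "H \<in> Sym m" "W \<in> Skew m"
    using assms(1) by (auto simp: SSkH_def)
  obtain H' W' where N: "N = four_block_mat H' (- W') W' H'" and HW': "H' \<in> Sym m" "W' \<in> Skew m"
    using assms(2) by (auto simp: SSkH_def)
  have "M - N = four_block_mat (H - H') (- (W - W')) (W - W') (H - H')"
    unfolding M N using HW HW' by (intro eq_matI) (auto simp: Sym_def Skew_def)
  then show ?thesis
    using Sym_minus[OF HW(1) HW'(1)] Skew_minus[OF HW(2) HW'(2)] by (auto simp: SSkH_def)
qed

lemma sskh_in_SSkH:
  assumes "A11 \<in> carrier_mat m m" "A12 \<in> carrier_mat m m"
    and "A21 \<in> carrier_mat m m" "A22 \<in> carrier_mat m m"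
  shows "sskh m (four_block_mat A11 A12 A21 A22) \<in> SSkH m"
proof -
  define H where "H = mat_sym (A11 + A22)"
  define W where "W = mat_skew (A21 - A12)"
  have H: "H \<in> Sym m" and W: "W \<in> Skew m"
    unfolding H_def W_def using assms by (auto intro!: mat_sym_in_Sym mat_skew_in_Skew)
  have "sskh m (four_block_mat A11 A12 A21 A22) = (1/2) \<cdot>\<^sub>m four_block_mat H (- W) W H"
    using sskh_four_block_mat[OF assms] by (simp add: H_def W_def)
  also have "\<dots> = four_block_mat ((1/2) \<cdot>\<^sub>m H) (- ((1/2) \<cdot>\<^sub>m W)) ((1/2) \<cdot>\<^sub>m W) ((1/2) \<cdot>\<^sub>m H)"
    using H W by (intro eq_matI) (auto simp: Sym_def Skew_def)
  finally have "sskh m (four_block_mat A11 A12 A21 A22) = \<dots>" .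
  moreover have "(1/2) \<cdot>\<^sub>m H \<in> Sym m"
    using H by (auto simp: Sym_def transpose_smult_mat)
  moreover have "(1/2) \<cdot>\<^sub>m W \<in> Skew m"
    using W by (auto simp: Skew_def transpose_smult_mat intro!: eq_matI)
  ultimately show ?thesis
    by (auto simp: SSkH_def)
qed

text \<open>
  Both sides reduce to pairing the sum \<open>A11 + A22\<close> with \<open>H\<close> and the difference \<open>A21 - A12\<close> with
  \<open>W\<close>, where taking the symmetric and the skew part changes nothing. So \<open>A - sskh m A\<close> is
  orthogonal to the subspace.
\<close>

lemma frob_inner_sskh:
  assumes A: "A11 \<in> carrier_mat m m" "A12 \<in> carrier_mat m m"
      "A21 \<in> carrier_mat m m" "A22 \<in> carrier_mat m m"
    and N: "N \<in> SSkH m"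
  shows "frob_inner (sskh m (four_block_mat A11 A12 A21 A22)) N
    = frob_inner (four_block_mat A11 A12 A21 A22) N"
proof -
  obtain H W where N: "N = four_block_mat H (- W) W H" and HW: "H \<in> Sym m" "W \<in> Skew m"
    using N by (auto simp: SSkH_def)
  have HW_carrier: "H \<in> carrier_mat m m" "W \<in> carrier_mat m m"
    using HW by (auto simp: Sym_def Skew_def)
  define B where "B = A11 + A22"
  define C where "C = A21 - A12"
  have B: "B \<in> carrier_mat m m" and C: "C \<in> carrier_mat m m"
    unfolding B_def C_def using A by auto
  have SB: "mat_sym B \<in> carrier_mat m m" and KC: "mat_skew C \<in> carrier_mat m m"
    using mat_sym_in_Sym[OF B] mat_skew_in_Skew[OF C] by (auto simp: Sym_def Skew_def)
  have "frob_inner (sskh m (four_block_mat A11 A12 A21 A22)) N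
      = (1/2) * frob_inner
          (four_block_mat (mat_sym B) (- mat_skew C) (mat_skew C) (mat_sym B)) N"
    using sskh_four_block_mat[OF A] by (simp add: B_def C_def frob_inner_smult_left)
  also have "\<dots> = (1/2) * (frob_inner (mat_sym B + mat_sym B) H
      + frob_inner (mat_skew C - - mat_skew C) W)"
    unfolding N using SB KC HW_carrier by (subst frob_inner_SSkH_pattern) auto
  also have "\<dots> = frob_inner (mat_sym B) H + frob_inner (mat_skew C) W"
    using SB KC frob_inner_minus_left[of "mat_skew C" m m "- mat_skew C" W]
    by (simp add: frob_inner_add_left[OF SB SB] frob_inner_uminus_left)
  also have "\<dots> = frob_inner B H + frob_inner C W"
    using frob_inner_mat_sym[OF B HW(1)] frob_inner_mat_skew[OF C HW(2)] by simp
  also have "\<dots> = frob_inner (four_block_mat A11 A12 A21 A22) N"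
    unfolding N B_def C_def using frob_inner_SSkH_pattern[OF A HW_carrier] by simp
  finally show ?thesis .
qed

theorem theorem8p1:
  fixes m :: nat and A :: "real mat"
  assumes "m \<ge> 1"
    and "A \<in> carrier_mat (2 * m) (2 * m)"
  shows "{M. is_arg_min (\<lambda>M. frobenius_norm (A - M)) (\<lambda>M. M \<in> SSkH m) M} = {sskh m A}"
proof -
  obtain A11 A12 A21 A22 where split: "split_block A m m = (A11, A12, A21, A22)"
    by (cases "split_block A m m") auto
  have dims: "dim_row A = m + m" "dim_col A = m + m"
    using assms(2) by auto
  note blocks = split_block[OF split dims]
  have P: "sskh m A \<in> SSkH m"
    unfolding blocks(5) by (rule sskh_in_SSkH[OF blocks(1-4)])
  show ?thesis
  proof (rule arg_min_frobenius_eqI[OF assms(2) _ P])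
    show "SSkH m \<subseteq> carrier_mat (2 * m) (2 * m)"
      using SSkH_carrier by blast
  next
    fix M assume "M \<in> SSkH m"
    then have "sskh m A - M \<in> SSkH m"
      using P SSkH_minus by blast
    then have "frob_inner (sskh m A) (sskh m A - M) = frob_inner A (sskh m A - M)"
      using frob_inner_sskh[OF blocks(1-4)] blocks(5) by metis
    then show "frob_inner (A - sskh m A) (sskh m A - M) = 0"
      using frob_inner_minus_left[OF assms(2) SSkH_carrier[OF P]] by simp
  qed
qed

end
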